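(* Let $q=2^r$ with $r\ge 4$ (so $q=4k$ with $k=2^{r-2}$, $r-2\ge 2$). Let $G_1,G_2,G_3\subseteq\mathfrak S_q$ be the groups defined below, and for $s=1,2,3$ let $f_s\in\mathbb F_q[X,Y]$ be a local permutation polynomial whose permutation polynomial tuple consists of the $q$ elements of $G_s$ (in some order). Then, for every $0\le e<r$, none of $f_1,f_2,f_3$ is equivalent to an $e$-Klenian polynomial over $\mathbb F_q$, and $f_1,f_2,f_3$ are pairwise inequivalent.
   Context: The elements of $\mathbb F_q$ are enumerated as $\mathbb F_q=\{c_0,\dots,c_{q-1}\}$; $\mathfrak S_q$ is the symmetric group of permutations of $\mathbb F_q$, composed right to left, $(\sigma\tau)(x)=\sigma(\tau(x))$, written in cycle notation. LPPs and tuples: every function $\mathbb F_q^2\to\mathbb F_q$ is identified with the unique polynomial in $\mathbb F_q[X,Y]$ of degree $<q$ in each variable representing it. $f\in\mathbb F_q[X,Y]$ is a local permutation polynomial (LPP) if $x\mapsto f(x,y_0)$ and $y\mapsto f(x_0,y)$ are permutations of $\mathbb F_q$ for all $x_0,y_0\in\mathbb F_q$. A permutation polynomial tuple is $(\beta_0,\dots,\beta_{q-1})\in\mathfrak S_q^q$ such that $\beta_i^{-1}\beta_j$ has no fixed point whenever $i\neq j$. LPPs $f$ correspond bijectively to permutation polynomial tuples $\underline\beta_f=(\beta_0,\dots,\beta_{q-1})$ via $f(x,\beta_i(x))=c_i$ for all $x\in\mathbb F_q$ and all $0\le i\le q-1$. Two LPPs $f,g$ with tuples $(\beta_0,\dots,\beta_{q-1})$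 and $(\gamma_0,\dots,\gamma_{q-1})$ are equivalent if there exist $\sigma,\lambda\in\mathfrak S_q$ with $\gamma_i=\sigma\beta_i\lambda$ for all $i$. $e$-Klenian polynomials: for $q=p^r$ ($p$ prime), $0\le e<r$, $\ell=p^e$, $t=q/\ell$, let $\alpha=\prod_{i=0}^{t-1}(c_{i\ell},c_{i\ell+1},\dots,c_{(i+1)\ell-1})$ and $\beta=\prod_{j=0}^{\ell-1}(c_j,c_{j+\ell},\dots,c_{j+(t-1)\ell})$, and $G=\{\alpha^i\beta^j:0\le i\le\ell-1,0\le j\le t-1\}$ (a subgroup of $\mathfrak S_q$ of order $q$ whose non-identity elements have no fixed points). An $e$-Klenian polynomial is an LPP whose permutation polynomial tuple consists of the $q$ elements of $G$ in some order. The groups: with $k=q/4$, let $a=(c_0,c_1)(c_2,c_3)\cdots(c_{q-2},c_{q-1})$ in all three cases. $G_1=\{b_1^ja^i:0\le j\le 2k-1,0\le i\le1\}$ where $b_1=C_1C_2$, $C_1$ the cycle with entries in order: for $m=0,\dots,\frac{k-2}{2}$ the pair $c_{2m},c_{2(2m+k-1)}$; then for $n=0,\dots,\frac{k-4}{2}$ the pair $c_{2n+k},c_{2(2n+k)}$; then $c_{4k-1},c_{4k-4}$; and $C_2$ the cycle with entries in order: for $m=0,\dots,\frac{k-2}{2}$ the pair $c_{2m+1},c_{2(2m+k)+1}$; then for $n=0,\dots,\frac{k-4}{2}$ the pair $c_{2n+k+1},c_{2(2n+k)-1}$; then $c_{4k-2},c_{4k-5}$. $G_2=\{b_2^ja^i:0\le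 j\le \frac q2-1,0\le i\le1\}$ where $b_2=(c_{\frac q2-2},c_{\frac q2-4},\dots,c_2,c_0,c_{\frac q2},c_{\frac q2+2},\dots,c_{q-2})(c_1,c_3,\dots,c_{\frac q2-1},c_{q-1},c_{q-3},\dots,c_{\frac q2+1})$. $G_3=\{b_3^ja^i:0\le j\le 2k-1,0\le i\le1\}$ where $b_3=D_1D_2$, $D_1$ the cycle with entries in order: for $i=0,\dots,\frac{k-2}{2}$ the pair $c_{2i},c_{2i+2k+1}$; then $c_{k+1},c_{3k}$; then for $j=0,\dots,\frac{k-4}{2}$ the pair $c_{k+2j+2},c_{3k+2j+2}$; and $D_2$ the cycle with entries in order: for $j=0,\dots,\frac{k-4}{2}$ the pair $c_{3k-2-2j},c_{2k-1-2j}$; then $c_{2k},c_k$; then for $i=0,\dots,\frac{k-2}{2}$ the pair $c_{4k-1-2i},c_{k-1-2i}$. Each $G_s$ is a subgroup of $\mathfrak S_q$ of order $q$ whose non-identity elements have no fixed points. *)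

theory Defs
  imports "HOL-Combinatorics.Cycles" "HOL-Library.Cardinality"
begin

text \<open>Functions F_q x F_q -> F_q are identified with their (reduced) polynomial
  representatives, so an LPP is a two-argument function on a finite field.
  The enumeration F_q = {c_0,...,c_{q-1}} is a bijection c from {0..<q} onto the field.\<close>

definition is_lpp :: "('a \<Rightarrow> 'a \<Rightarrow> 'a) \<Rightarrow> bool" where
  "is_lpp f \<longleftrightarrow> (\<forall>y0. bij (\<lambda>x. f x y0)) \<and> (\<forall>x0. bij (\<lambda>y. f x0 y))"

definition ppt :: "(nat \<Rightarrow> 'a) \<Rightarrow> ('a \<Rightarrow> 'a \<Rightarrow> 'a) \<Rightarrow> nat \<Rightarrow> 'a \<Rightarrow> 'a" where
  "ppt c f i = (\<lambda>x. THE y. f x y = c i)"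

definition lpp_equiv :: "(nat \<Rightarrow> 'a::finite) \<Rightarrow> ('a \<Rightarrow> 'a \<Rightarrow> 'a) \<Rightarrow> ('a \<Rightarrow> 'a \<Rightarrow> 'a) \<Rightarrow> bool" where
  "lpp_equiv c f g \<longleftrightarrow> (\<exists>\<sigma> \<tau>. bij \<sigma> \<and> bij \<tau> \<and>
      (\<forall>i. i < CARD('a) \<longrightarrow> ppt c g i = \<sigma> \<circ> ppt c f i \<circ> \<tau>))"

definition ppt_set :: "(nat \<Rightarrow> 'a::finite) \<Rightarrow> ('a \<Rightarrow> 'a \<Rightarrow> 'a) \<Rightarrow> ('a \<Rightarrow> 'a) set" where
  "ppt_set c f = ppt c f ` {0..<CARD('a)}"

text \<open>Product of cycles (composition right to left; here the cycles are disjoint).\<close>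
definition cycle_prod :: "'a list list \<Rightarrow> 'a \<Rightarrow> 'a" where
  "cycle_prod ls = foldr (\<lambda>l g. cycle_of_list l \<circ> g) ls id"

definition klen_alpha :: "(nat \<Rightarrow> 'a) \<Rightarrow> nat \<Rightarrow> nat \<Rightarrow> 'a \<Rightarrow> 'a" where
  "klen_alpha c q l = cycle_prod (map (\<lambda>i. map (\<lambda>m. c (i * l + m)) [0..<l]) [0..<q div l])"

definition klen_beta :: "(nat \<Rightarrow> 'a) \<Rightarrow> nat \<Rightarrow> nat \<Rightarrow> 'a \<Rightarrow> 'a" where
  "klen_beta c q l = cycle_prod (map (\<lambda>j. map (\<lambda>m. c (j + m * l)) [0..<q div l]) [0..<l])"

definition klenian_group :: "(nat \<Rightarrow> 'a) \<Rightarrow> nat \<Rightarrow> nat \<Rightarrow> ('a \<Rightarrow> 'a) set" where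
  "klenian_group c q l = {(klen_alpha c q l ^^ i) \<circ> (klen_beta c q l ^^ j) | i j. i < l \<and> j < q div l}"

definition is_e_klenian :: "(nat \<Rightarrow> 'a::finite) \<Rightarrow> nat \<Rightarrow> nat \<Rightarrow> ('a \<Rightarrow> 'a \<Rightarrow> 'a) \<Rightarrow> bool" where
  "is_e_klenian c p e f \<longleftrightarrow> is_lpp f \<and> ppt_set c f = klenian_group c CARD('a) (p ^ e)"

definition perm_a :: "(nat \<Rightarrow> 'a) \<Rightarrow> nat \<Rightarrow> 'a \<Rightarrow> 'a" where
  "perm_a c q = cycle_prod (map (\<lambda>i. [c (2*i), c (2*i+1)]) [0..<q div 2])"

definition cycC1 :: "(nat \<Rightarrow> 'a) \<Rightarrow> nat \<Rightarrow> 'a list" where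
  "cycC1 c k =
     concat (map (\<lambda>m. [c (2*m), c (2*(2*m+k-1))]) [0..<k div 2])
   @ concat (map (\<lambda>n. [c (2*n+k), c (2*(2*n+k))]) [0..<k div 2 - 1])
   @ [c (4*k-1), c (4*k-4)]"

definition cycC2 :: "(nat \<Rightarrow> 'a) \<Rightarrow> nat \<Rightarrow> 'a list" where
  "cycC2 c k =
     concat (map (\<lambda>m. [c (2*m+1), c (2*(2*m+k)+1)]) [0..<k div 2])
   @ concat (map (\<lambda>n. [c (2*n+k+1), c (2*(2*n+k)-1)]) [0..<k div 2 - 1])
   @ [c (4*k-2), c (4*k-5)]"

definition perm_b1 :: "(nat \<Rightarrow> 'a) \<Rightarrow> nat \<Rightarrow> 'a \<Rightarrow> 'a" where
  "perm_b1 c q = cycle_prod [cycC1 c (q div 4), cycC2 c (q div 4)]"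

definition perm_b2 :: "(nat \<Rightarrow> 'a) \<Rightarrow> nat \<Rightarrow> 'a \<Rightarrow> 'a" where
  "perm_b2 c q = cycle_prod
     [rev (map (\<lambda>i. c (2*i)) [0..<q div 4]) @ map (\<lambda>i. c (q div 2 + 2*i)) [0..<q div 4],
      map (\<lambda>i. c (2*i+1)) [0..<q div 4] @ rev (map (\<lambda>i. c (q div 2 + 1 + 2*i)) [0..<q div 4])]"

definition cycD1 :: "(nat \<Rightarrow> 'a) \<Rightarrow> nat \<Rightarrow> 'a list" where
  "cycD1 c k =
     concat (map (\<lambda>i. [c (2*i), c (2*i+2*k+1)]) [0..<k div 2])
   @ [c (k+1), c (3*k)]
   @ concat (map (\<lambda>j. [c (k+2*j+2), c (3*k+2*j+2)]) [0..<k div 2 - 1])"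

definition cycD2 :: "(nat \<Rightarrow> 'a) \<Rightarrow> nat \<Rightarrow> 'a list" where
  "cycD2 c k =
     concat (map (\<lambda>j. [c (3*k-2-2*j), c (2*k-1-2*j)]) [0..<k div 2 - 1])
   @ [c (2*k), c k]
   @ concat (map (\<lambda>i. [c (4*k-1-2*i), c (k-1-2*i)]) [0..<k div 2])"

definition perm_b3 :: "(nat \<Rightarrow> 'a) \<Rightarrow> nat \<Rightarrow> 'a \<Rightarrow> 'a" where
  "perm_b3 c q = cycle_prod [cycD1 c (q div 4), cycD2 c (q div 4)]"

definition group_from :: "('a \<Rightarrow> 'a) \<Rightarrow> ('a \<Rightarrow> 'a) \<Rightarrow> nat \<Rightarrow> ('a \<Rightarrow> 'a) set" where
  "group_from b a n = {(b ^^ j) \<circ> (a ^^ i) | j i. j < n \<and> i < 2}"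

definition G1 :: "(nat \<Rightarrow> 'a) \<Rightarrow> nat \<Rightarrow> ('a \<Rightarrow> 'a) set" where
  "G1 c q = group_from (perm_b1 c q) (perm_a c q) (2 * (q div 4))"

definition G2 :: "(nat \<Rightarrow> 'a) \<Rightarrow> nat \<Rightarrow> ('a \<Rightarrow> 'a) set" where
  "G2 c q = group_from (perm_b2 c q) (perm_a c q) (q div 2)"

definition G3 :: "(nat \<Rightarrow> 'a) \<Rightarrow> nat \<Rightarrow> ('a \<Rightarrow> 'a) set" where
  "G3 c q = group_from (perm_b3 c q) (perm_a c q) (2 * (q div 4))"

end

(* With n = q/2 = 2k, the permutations a and b = b_s generate a split metacyclic group:
   b has order n, a is an involution and a b a = b^m, where m = k + 1 (modular) for s = 1,
   m = 2k - 1 (dihedral) for s = 2 and m = k - 1 (semidihedral) for s = 3.  If the source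
   tuple of an equivalence is a group and the target tuple contains the identity, the
   equivalence is conjugation by a bijection, so it embeds the source group in the target
   group.  Three properties inherited along embeddings separate the groups: commutativity
   (only the Klenian groups have it), commutation of any two elements of order greater
   than 2 (the dihedral group has it, the modular and semidihedral groups do not), and
   centrality of all squares (the modular group has it, the semidihedral group does not). *)
theory Submission
  imports Defs
begin

section \<open>Products of disjoint cycles\<close>

lemma cycle_of_list_nth:
  assumes "distinct l" "i < length l"
  shows "cycle_of_list l (l ! i) = l ! (Suc i mod length l)"
proof -
  have "map ((cycle_of_list l) ^^ 1) l = rotate 1 l"
    using assms(1) by (rule cyclic_rotation)
  then have "map (cycle_of_list l) l ! i = rotate 1 l ! i" by simp
  then show ?thesis using assms by (simp add: nth_rotate del: rotate_Suc)
qed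

lemma cycle_prod_outside:
  "x \<notin> set (concat ls) \<Longrightarrow> cycle_prod ls x = x"
  by (induction ls) (simp_all add: cycle_prod_def id_outside_supp)

text \<open>Disjointness lets exactly one factor act on a given entry. If \<open>l\<close> comes
  later in the list, the image still lies in \<open>l\<close> and is fixed by the head cycle; if
  \<open>l\<close> is the head, all later factors have already fixed the entry.\<close>

lemma cycle_prod_nth:
  assumes "distinct (concat ls)" "l \<in> set ls" "i < length l"
  shows "cycle_prod ls (l ! i) = l ! (Suc i mod length l)"
  using assms
proof (induction ls)
  case (Cons l' ls)
  have step: "cycle_prod (l' # ls) x = cycle_of_list l' (cycle_prod ls x)" for x
    by (simp add: cycle_prod_def)
  have mod: "Suc i mod length l < length l" using Cons.prems(3) by (intro mod_less_divisor) auto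
  show ?case
  proof (cases "l \<in> set ls")
    case True
    then have "l ! (Suc i mod length l) \<in> set (concat ls)"
      using mod by (auto intro!: bexI[of _ l])
    then have "l ! (Suc i mod length l) \<notin> set l'" using Cons.prems(1) by auto
    moreover have "cycle_prod ls (l ! i) = l ! (Suc i mod length l)"
      using Cons True by simp
    ultimately show ?thesis by (simp add: step id_outside_supp)
  next
    case False
    then have l: "l = l'" using Cons.prems by simp
    then have "l ! i \<notin> set (concat ls)" using Cons.prems by (auto dest: nth_mem)
    then have "cycle_prod ls (l ! i) = l ! i" by (rule cycle_prod_outside)
    then show ?thesis using l Cons.prems by (simp add: step cycle_of_list_nth)
  qed
qed simp

lemma cycle_prod_map_nth:
  assumes "\<And>i. i < N \<Longrightarrow> distinct (L i)"
    and disj: "\<And>i j. i < N \<Longrightarrow> j < N \<Longrightarrow> i \<noteq> j \<Longrightarrow> set (L i) \<inter> set (L j) = {}"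
    and "i < N" "m < length (L i)"
  shows "cycle_prod (map L [0..<N]) (L i ! m) = L i ! (Suc m mod length (L i))"
proof (rule cycle_prod_nth)
  have "distinct (concat (map L [0..<M]))" if "M \<le> N" for M
    using that
  proof (induction M)
    case (Suc M)
    have "x \<notin> set (L M)" if "j < M" "x \<in> set (L j)" for j x
      using disj[of j M] that Suc.prems by auto
    then show ?case using Suc assms(1)[of M] by auto
  qed simp
  then show "distinct (concat (map L [0..<N]))" by simp
qed (use assms in auto)

text \<open>The cycles of b_1 and b_3 are given in segments of pairs. This turns one segment into
  the restriction of a single index map to an interval of positions, so that adjacent segments can
  be glued.\<close>

lemma concat_map_pairs:
  assumes "\<And>i. i < l \<Longrightarrow> f (2 * (s + i)) = x i \<and> f (2 * (s + i) + 1) = y i"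
    and "s + l = e"
  shows "concat (map (\<lambda>i. [x i, y i]) [0..<l]) = map f [2 * s..<2 * e]"
  unfolding assms(2)[symmetric] using assms(1) by (induction l) simp_all

lemma upt_split3:
  assumes "u \<le> v" "v \<le> w"
  shows "[0..<w] = [0..<u] @ [u..<v] @ [v..<w]"
  using assms upt_add_eq_append[of 0 u "w - u"] upt_add_eq_append[of u v "w - v"] by simp

lemma klen_index_less:
  fixes i m l :: nat
  assumes "l dvd q" "i < q div l" "m < l"
  shows "i * l + m < q"
proof -
  have "i * l + m < Suc i * l" using assms(3) by simp
  also have "\<dots> \<le> (q div l) * l" using assms(2) by (intro mult_right_mono) auto
  finally show ?thesis using assms(1) by simp
qed

lemma index_eq_iff:
  fixes i j m n l :: nat
  assumes "m < l" "n < l"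
  shows "i * l + m = j * l + n \<longleftrightarrow> i = j \<and> m = n"
proof
  assume eq: "i * l + m = j * l + n"
  have "(i * l + m) div l = i" "(j * l + n) div l = j"
       "(i * l + m) mod l = m" "(j * l + n) mod l = n" using assms by simp_all
  then show "i = j \<and> m = n" using eq by metis
qed simp

section \<open>The Klenian generators and the involution a in coordinates\<close>

locale enumeration =
  fixes c :: "nat \<Rightarrow> 'a::finite"
  assumes bij: "bij_betw c {0..<CARD('a)} UNIV"
begin

lemma c_eq_iff: "i < CARD('a) \<Longrightarrow> j < CARD('a) \<Longrightarrow> c i = c j \<longleftrightarrow> i = j"
  using bij by (auto simp: bij_betw_def inj_on_def)

lemma c_cases: obtains i where "i < CARD('a)" "x = c i"
proof -
  have "x \<in> c ` {0..<CARD('a)}" using bij by (simp add: bij_betw_def)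
  then show ?thesis using that by auto
qed

text \<open>Arrange the indices in a grid with row i and column m at i * l + m. The cycles of alpha
  are the rows; those of beta, treated next, are the columns.\<close>

lemma klen_alpha_apply:
  assumes "l dvd CARD('a)" "i < CARD('a) div l" "m < l"
  shows "klen_alpha c CARD('a) l (c (i * l + m)) = c (i * l + Suc m mod l)"
proof -
  let ?L = "\<lambda>i. map (\<lambda>m. c (i * l + m)) [0..<l]"
  have "cycle_prod (map ?L [0..<CARD('a) div l]) (?L i ! m) = ?L i ! (Suc m mod length (?L i))"
    by (rule cycle_prod_map_nth)
      (use assms in \<open>auto simp: distinct_map inj_on_def c_eq_iff klen_index_less index_eq_iff\<close>)
  then show ?thesis using assms by (simp add: klen_alpha_def)
qed

lemma klen_beta_apply:
  assumes "l dvd CARD('a)" "i < CARD('a) div l" "m < l"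
  shows "klen_beta c CARD('a) l (c (i * l + m)) = c ((Suc i mod (CARD('a) div l)) * l + m)"
proof -
  let ?L = "\<lambda>j. map (\<lambda>m. c (j + m * l)) [0..<CARD('a) div l]"
  \<comment> \<open>\<open>klen_beta\<close> writes the column first; with the summands swapped,
    \<open>klen_index_less\<close> and \<open>index_eq_iff\<close> apply.\<close>
  have "j + m * l = m * l + j" for j m :: nat by simp
  note swap = this
  have "cycle_prod (map ?L [0..<l]) (?L m ! i) = ?L m ! (Suc i mod length (?L m))"
    by (rule cycle_prod_map_nth, unfold swap)
      (use assms in \<open>auto simp: distinct_map inj_on_def c_eq_iff klen_index_less index_eq_iff\<close>)
  then show ?thesis using assms by (simp add: klen_beta_def add.commute)
qed

text \<open>In the grid, the two maps shift different coordinates cyclically.\<close>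

lemma klen_alpha_beta_commute:
  assumes l: "l dvd CARD('a)"
  shows "klen_alpha c CARD('a) l \<circ> klen_beta c CARD('a) l
       = klen_beta c CARD('a) l \<circ> klen_alpha c CARD('a) l"
proof
  fix x
  obtain n where n: "n < CARD('a)" "x = c n" by (rule c_cases)
  have "l > 0" using l by (auto intro: Nat.gr0I)
  define i m where "i = n div l" and "m = n mod l"
  have im: "i < CARD('a) div l" "m < l" "n = i * l + m"
    using n l \<open>l > 0\<close> by (auto simp: i_def m_def less_mult_imp_div_less)
  then have "Suc i mod (CARD('a) div l) < CARD('a) div l" "Suc m mod l < l"
    by simp_all
  then show "(klen_alpha c CARD('a) l \<circ> klen_beta c CARD('a) l) x
       = (klen_beta c CARD('a) l \<circ> klen_alpha c CARD('a) l) x"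
    using im l n by (simp add: klen_alpha_apply klen_beta_apply)
qed

lemma perm_a_apply:
  assumes "even CARD('a)" "i < CARD('a) div 2"
  shows "perm_a c CARD('a) (c (2 * i)) = c (2 * i + 1)"
    and "perm_a c CARD('a) (c (2 * i + 1)) = c (2 * i)"
proof -
  let ?L = "\<lambda>i. [c (2 * i), c (2 * i + 1)]"
  have D: "cycle_prod (map ?L [0..<CARD('a) div 2]) (?L i ! m) = ?L i ! (Suc m mod length (?L i))"
    if "m < 2" for m
    by (rule cycle_prod_map_nth) (use assms that in \<open>auto simp: c_eq_iff\<close>)
  show "perm_a c CARD('a) (c (2 * i)) = c (2 * i + 1)"
    using D[of 0] assms by (simp add: perm_a_def)
  show "perm_a c CARD('a) (c (2 * i + 1)) = c (2 * i)"
    using D[of 1] assms by (simp add: perm_a_def)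
qed

lemma perm_a_c:
  assumes "even CARD('a)" "i < CARD('a)"
  shows "perm_a c CARD('a) (c i) = c (if even i then i + 1 else i - 1)"
proof (cases "even i")
  case True
  then obtain j where "i = 2 * j" by (elim evenE)
  then show ?thesis using perm_a_apply(1)[of j] assms by auto
next
  case False
  then obtain j where "i = 2 * j + 1" by (elim oddE)
  then show ?thesis using perm_a_apply(2)[of j] assms by auto
qed

lemma perm_a_involution:
  assumes "even CARD('a)"
  shows "perm_a c CARD('a) \<circ> perm_a c CARD('a) = id"
proof
  fix x
  obtain i where i: "i < CARD('a)" "x = c i" by (rule c_cases)
  \<comment> \<open>As q is even, the partner i + 1 of an even index i < q is again below q.\<close>
  have "Suc i \<noteq> CARD('a)" if "even i" using assms that by (metis even_Suc)
  then have "(if even i then i + 1 else i - 1) < CARD('a)"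
    using i(1) by auto
  then show "(perm_a c CARD('a) \<circ> perm_a c CARD('a)) x = id x"
    using i assms by (auto simp: perm_a_c)
qed

end

section \<open>Split metacyclic groups of functions\<close>

lemma funpow_comp: "(f ^^ i) \<circ> (f ^^ j) = f ^^ (i + j)"
  by (simp add: funpow_add)

text \<open>The relations are a^2 = 1, b^n = 1 and a b a = b^m. The later tests for noncommuting
  elements and nontrivial squares all come down to comparing powers of b, which the exact order n
  decides.\<close>

locale split_metacyclic =
  fixes a b :: "'a \<Rightarrow> 'a" and n m :: nat
  assumes a_a: "a (a x) = x"
    and b_n: "b ^^ n = id"
    and b_order: "0 < j \<Longrightarrow> j < n \<Longrightarrow> b ^^ j \<noteq> id"
    and a_b: "a (b x) = (b ^^ m) (a x)"
    and n_pos: "0 < n"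
begin

lemma a_b_pow: "a ((b ^^ j) x) = (b ^^ (m * j)) (a x)"
  by (induction j arbitrary: x) (simp_all add: a_b funpow_add)

lemma b_pow_mod: "b ^^ (j mod n) = b ^^ j"
proof -
  have "b ^^ j = b ^^ (j mod n + n * (j div n))" by simp
  also have "\<dots> = (b ^^ (j mod n)) \<circ> ((b ^^ n) ^^ (j div n))"
    unfolding funpow_add funpow_mult by (simp add: mult.commute)
  finally show ?thesis by (simp add: b_n)
qed

lemma b_pow_id_iff: "b ^^ j = id \<longleftrightarrow> n dvd j"
  using b_pow_mod[of j] b_order[of "j mod n"] n_pos
  by (auto simp: mod_eq_0_iff_dvd[symmetric] b_n)

text \<open>The power b^(n-1) is a left inverse of b, so b is injective and b^i can be
  cancelled.\<close>

lemma b_pow_eq_imp_dvd: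
  assumes "b ^^ i = b ^^ j" "i \<le> j"
  shows "n dvd j - i"
proof -
  obtain n' where n': "n = Suc n'" using n_pos by (cases n) auto
  have "inj b"
  proof (rule inj_on_inverseI)
    show "(b ^^ n') (b x) = x" for x
      using fun_cong[OF b_n, of x] by (simp add: n' funpow_swap1)
  qed
  then have "inj (b ^^ i)" by (rule inj_fn)
  moreover have "(b ^^ i) ((b ^^ (j - i)) x) = (b ^^ i) x" for x
    using assms by (metis funpow_add comp_apply le_add_diff_inverse)
  ultimately have "b ^^ (j - i) = id" by (auto simp: inj_def)
  then show ?thesis by (simp add: b_pow_id_iff)
qed

lemma a_pow_mod: "a ^^ (i mod 2) = a ^^ i"
proof -
  have "a \<circ> a = id" by (auto simp: a_a)
  then have "a ^^ 2 = id" by (simp add: numeral_2_eq_2)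
  have "a ^^ i = a ^^ (i mod 2 + 2 * (i div 2))" by simp
  also have "\<dots> = (a ^^ (i mod 2)) \<circ> ((a ^^ 2) ^^ (i div 2))"
    unfolding funpow_add funpow_mult by (simp add: mult.commute)
  finally show ?thesis by (simp add: \<open>a ^^ 2 = id\<close>)
qed

text \<open>The exponents are arbitrary here, so products need not be reduced modulo n and 2 by
  hand.\<close>

lemma mem_group: "(b ^^ j) \<circ> (a ^^ i) \<in> group_from b a n"
proof -
  have "(b ^^ j) \<circ> (a ^^ i) = (b ^^ (j mod n)) \<circ> (a ^^ (i mod 2))"
    by (simp add: b_pow_mod a_pow_mod)
  moreover have "j mod n < n" "i mod 2 < 2" using n_pos by simp_all
  ultimately show ?thesis unfolding group_from_def by blast
qed

lemma group_cases:
  assumes "g \<in> group_from b a n"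
  obtains j where "g = b ^^ j" | j where "g = (b ^^ j) \<circ> a"
proof -
  obtain j i where "g = (b ^^ j) \<circ> (a ^^ i)" "i < 2"
    using assms by (auto simp: group_from_def)
  then show ?thesis using that by (cases "i = 0") (auto simp: less_2_cases_iff)
qed

lemma b_pow_mem: "b ^^ j \<in> group_from b a n"
  using mem_group[of j 0] by simp

lemma b_pow_a_mem: "(b ^^ j) \<circ> a \<in> group_from b a n"
  using mem_group[of j 1] by simp

text \<open>Moving a past b^j turns it into b^(mj), so each of the four products of elements b^i or
  b^i a is again of one of these forms.\<close>

lemma group_closed:
  assumes "g \<in> group_from b a n" "h \<in> group_from b a n"
  shows "g \<circ> h \<in> group_from b a n"
proof -
  have 1: "(b ^^ i) \<circ> (b ^^ j) = b ^^ (i + j)" for i j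
    by (rule funpow_comp)
  have 2: "(b ^^ i) \<circ> ((b ^^ j) \<circ> a) = (b ^^ (i + j)) \<circ> a" for i j
    by (simp add: funpow_add comp_assoc)
  have 3: "((b ^^ i) \<circ> a) \<circ> (b ^^ j) = (b ^^ (i + m * j)) \<circ> a" for i j
    by (auto simp: funpow_add a_b_pow)
  have 4: "((b ^^ i) \<circ> a) \<circ> ((b ^^ j) \<circ> a) = b ^^ (i + m * j)" for i j
    by (auto simp: funpow_add a_b_pow a_a)
  show ?thesis
    using assms by (elim group_cases) (simp_all only: 1 2 3 4 b_pow_mem b_pow_a_mem)
qed

text \<open>If a and b commuted, a b a = b^m would read b = b^m, forcing n to divide m - 1.\<close>

lemma not_commute:
  assumes "\<not> n dvd m - 1" "m \<ge> 1"
  shows "a \<circ> b \<noteq> b \<circ> a"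
proof
  assume *: "a \<circ> b = b \<circ> a"
  have "(b ^^ m) x = b x" for x
    using a_b[of "a x"] fun_cong[OF *, of "a x"] by (simp add: a_a)
  then have "b ^^ 1 = b ^^ m" by auto
  then show False using b_pow_eq_imp_dvd[of 1 m] assms by simp
qed

end

section \<open>Positions of the indices in the two cycles of b_1, b_2 and b_3\<close>

text \<open>The index maps below list the entries of the two cycles of \<open>b\<^sub>1\<close> (\<open>C\<close>), \<open>b\<^sub>2\<close> (\<open>B\<close>) and
  \<open>b\<^sub>3\<close> (\<open>D\<close>) by their positions; the maps ending in \<open>swap\<close> give the position in the second cycle
  of the image under \<open>a\<close> of a position in the first.\<close>

definition C1_index :: "nat \<Rightarrow> nat \<Rightarrow> nat" where
  "C1_index k t = (if t = 2 * k - 2 then 4 * k - 1 else if even t then t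
    else if t < k then 2 * (t + k - 2) else 2 * (t - 1))"

definition C2_index :: "nat \<Rightarrow> nat \<Rightarrow> nat" where
  "C2_index k t = (if t = 2 * k - 2 then 4 * k - 2 else if even t then t + 1
    else if t < k then 2 * (t + k) - 1 else 2 * t - 3)"

definition B1_index :: "nat \<Rightarrow> nat \<Rightarrow> nat" where
  "B1_index k t = (if t < k then 2 * (k - 1 - t) else 2 * t)"

definition B2_index :: "nat \<Rightarrow> nat \<Rightarrow> nat" where
  "B2_index k t = (if t < k then 2 * t + 1 else 6 * k - 1 - 2 * t)"

definition D1_index :: "nat \<Rightarrow> nat \<Rightarrow> nat" where
  "D1_index k t = (if t = k then k + 1 else if even t then t
    else if t < k then t + 2 * k else t + 2 * k - 1)"

definition D2_index :: "nat \<Rightarrow> nat \<Rightarrow> nat" where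
  "D2_index k t = (if t = k - 1 then k else if odd t then 2 * k - t
    else if t < k then 3 * k - 2 - t else 5 * k - 1 - t)"

text \<open>With k = 4g + 4, positions below 2k are split by parity and by half. Away from the
  exceptional positions, the index maps for b_1 and b_3 are then linear in g and x, within reach of
  arithmetic automation.\<close>

lemma index_cases:
  fixes g :: nat
  assumes "t < 8 * g + 8"
  obtains (even_lo) x where "t = 2 * x" "x < 2 * g + 2"
    | (odd_lo) x where "t = 2 * x + 1" "x < 2 * g + 2"
    | (even_hi) x where "t = 4 * g + 4 + 2 * x" "x < 2 * g + 2"
    | (odd_hi) x where "t = 4 * g + 5 + 2 * x" "x < 2 * g + 2"
proof (cases "t < 4 * g + 4")
  case True
  then show ?thesis using that(1)[of "t div 2"] that(2)[of "t div 2"] by (cases "even t") auto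
next
  case False
  then obtain v where "t = 4 * g + 4 + v" using le_Suc_ex[of "4 * g + 4" t] by auto
  then show ?thesis using that(3)[of "v div 2"] that(4)[of "v div 2"] assms by (cases "even v") auto
qed
definition C_swap :: "nat \<Rightarrow> nat \<Rightarrow> nat" where
  "C_swap k t = (if even t then t else if t < k then t + k else t - k)"

lemma C_less1:
  assumes "k = 4 * g + 4"
  shows "t < 2 * k \<Longrightarrow> C1_index k t < 2 * (2 * k)"
  by (cases t rule: index_cases[of _ g];
      simp add: C1_index_def C2_index_def C_swap_def assms split: if_splits) (arith+)?

lemma C_inj1:
  assumes "k = 4 * g + 4"
  shows "s < 2 * k \<Longrightarrow> t < 2 * k \<Longrightarrow> C1_index k s = C1_index k t \<Longrightarrow> s = t"
  by (cases s rule: index_cases[of _ g]; cases t rule: index_cases[of _ g];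
      simp add: C1_index_def C2_index_def C_swap_def assms split: if_splits) (arith+)?

lemma C_less2:
  assumes "k = 4 * g + 4"
  shows "t < 2 * k \<Longrightarrow> C2_index k t < 2 * (2 * k)"
  by (cases t rule: index_cases[of _ g];
      simp add: C1_index_def C2_index_def C_swap_def assms split: if_splits) (arith+)?

text \<open>The values at odd t below and above k have overlapping ranges, but the former are 1 and
  the latter 3 modulo 4. The parity of z div 2 detects this residue.\<close>

lemma C_inj2:
  assumes "k = 4 * g + 4"
  shows "s < 2 * k \<Longrightarrow> t < 2 * k \<Longrightarrow> C2_index k s = C2_index k t \<Longrightarrow> s = t"
  by (cases s rule: index_cases[of _ g]; cases t rule: index_cases[of _ g];
      simp add: C1_index_def C2_index_def C_swap_def assms split: if_splits)
    (auto dest: arg_cong[where f = "\<lambda>z. even (z div 2)"])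

text \<open>The first cycle carries the even indices and the second the odd ones, except that 4k - 2
  and 4k - 1 trade places.\<close>

lemma C_disjoint:
  assumes "k = 4 * g + 4"
  shows "s < 2 * k \<Longrightarrow> t < 2 * k \<Longrightarrow> C1_index k s \<noteq> C2_index k t"
  by (cases s rule: index_cases[of _ g]; cases t rule: index_cases[of _ g];
      simp add: C1_index_def C2_index_def C_swap_def assms split: if_splits)
    (auto dest: arg_cong[where f = even])

lemma C_swap_less:
  assumes "k = 4 * g + 4"
  shows "t < 2 * k \<Longrightarrow> C_swap k t < 2 * k"
  by (cases t rule: index_cases[of _ g];
      simp add: C1_index_def C2_index_def C_swap_def assms split: if_splits) (arith+)?

lemma C_swap:
  assumes "k = 4 * g + 4"
  shows "t < 2 * k \<Longrightarrow>
    (if even (C1_index k t) then C1_index k t + 1 else C1_index k t - 1) = C2_index k (C_swap k t)"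
  by (cases t rule: index_cases[of _ g];
      simp add: C1_index_def C2_index_def C_swap_def assms split: if_splits) (arith+)?

definition B_swap :: "nat \<Rightarrow> nat \<Rightarrow> nat" where
  "B_swap k t = (if t < k then k - 1 - t else 3 * k - 1 - t)"

lemma B_less1:
  assumes "0 < k"
  shows "t < 2 * k \<Longrightarrow> B1_index k t < 2 * (2 * k)"
  using assms by (auto simp: B1_index_def B2_index_def B_swap_def split: if_splits; presburger)

lemma B_inj1:
  assumes "0 < k"
  shows "s < 2 * k \<Longrightarrow> t < 2 * k \<Longrightarrow> B1_index k s = B1_index k t \<Longrightarrow> s = t"
  using assms by (auto simp: B1_index_def B2_index_def B_swap_def split: if_splits; presburger)

lemma B_less2:
  assumes "0 < k"
  shows "t < 2 * k \<Longrightarrow> B2_index k t < 2 * (2 * k)"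
  using assms by (auto simp: B1_index_def B2_index_def B_swap_def split: if_splits; presburger)

lemma B_inj2:
  assumes "0 < k"
  shows "s < 2 * k \<Longrightarrow> t < 2 * k \<Longrightarrow> B2_index k s = B2_index k t \<Longrightarrow> s = t"
  using assms by (auto simp: B1_index_def B2_index_def B_swap_def split: if_splits; presburger)

lemma B_disjoint:
  assumes "0 < k"
  shows "s < 2 * k \<Longrightarrow> t < 2 * k \<Longrightarrow> B1_index k s \<noteq> B2_index k t"
  using assms by (auto simp: B1_index_def B2_index_def B_swap_def split: if_splits; presburger)

lemma B_swap_less:
  assumes "0 < k"
  shows "t < 2 * k \<Longrightarrow> B_swap k t < 2 * k"
  using assms by (auto simp: B1_index_def B2_index_def B_swap_def split: if_splits; presburger)

lemma B_swap:
  assumes "0 < k"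
  shows "t < 2 * k \<Longrightarrow>
    (if even (B1_index k t) then B1_index k t + 1 else B1_index k t - 1) = B2_index k (B_swap k t)"
  using assms by (auto simp: B1_index_def B2_index_def B_swap_def split: if_splits; presburger)

definition D_swap :: "nat \<Rightarrow> nat \<Rightarrow> nat" where
  "D_swap k t = (if even t then 2 * k - 1 - t else if t < k then k - 1 - t else 3 * k - 1 - t)"

lemma D_less1:
  assumes "k = 4 * g + 4"
  shows "t < 2 * k \<Longrightarrow> D1_index k t < 2 * (2 * k)"
  by (cases t rule: index_cases[of _ g];
      simp add: D1_index_def D2_index_def D_swap_def assms split: if_splits) (arith+)?

lemma D_inj1:
  assumes "k = 4 * g + 4"
  shows "s < 2 * k \<Longrightarrow> t < 2 * k \<Longrightarrow> D1_index k s = D1_index k t \<Longrightarrow> s = t"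
  by (cases s rule: index_cases[of _ g]; cases t rule: index_cases[of _ g];
      simp add: D1_index_def D2_index_def D_swap_def assms split: if_splits) (arith+)?

lemma D_less2:
  assumes "k = 4 * g + 4"
  shows "t < 2 * k \<Longrightarrow> D2_index k t < 2 * (2 * k)"
  by (cases t rule: index_cases[of _ g];
      simp add: D1_index_def D2_index_def D_swap_def assms split: if_splits) (arith+)?

lemma D_inj2:
  assumes "k = 4 * g + 4"
  shows "s < 2 * k \<Longrightarrow> t < 2 * k \<Longrightarrow> D2_index k s = D2_index k t \<Longrightarrow> s = t"
  by (cases s rule: index_cases[of _ g]; cases t rule: index_cases[of _ g];
      simp add: D1_index_def D2_index_def D_swap_def assms split: if_splits) (arith+)?

lemma D_disjoint:
  assumes "k = 4 * g + 4" and "s < 2 * k" "t < 2 * k"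
  shows "D1_index k s \<noteq> D2_index k t"
proof
  assume eq: "D1_index k s = D2_index k t"
  \<comment> \<open>The parity equation follows from the equality; as a separate premise it exposes
    the contradiction in cases where the two values differ in parity.\<close>
  have "s < 2 * k \<Longrightarrow> t < 2 * k \<Longrightarrow> D1_index k s = D2_index k t \<Longrightarrow>
    even (D1_index k s) = even (D2_index k t) \<Longrightarrow> False"
    by (cases s rule: index_cases[of _ g]; cases t rule: index_cases[of _ g];
        simp add: D1_index_def D2_index_def assms(1) split: if_splits) (linarith | auto | arith)+
  then show False using assms(2,3) eq by simp
qed

lemma D_swap_less:
  assumes "k = 4 * g + 4"
  shows "t < 2 * k \<Longrightarrow> D_swap k t < 2 * k"
  by (cases t rule: index_cases[of _ g];
      simp add: D1_index_def D2_index_def D_swap_def assms split: if_splits) (arith+)?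

lemma D_swap:
  assumes "k = 4 * g + 4"
  shows "t < 2 * k \<Longrightarrow>
    (if even (D1_index k t) then D1_index k t + 1 else D1_index k t - 1) = D2_index k (D_swap k t)"
  by (cases t rule: index_cases[of _ g];
      simp add: D1_index_def D2_index_def D_swap_def assms split: if_splits) (arith+)?

section \<open>The three groups satisfy the split metacyclic relations\<close>

context enumeration
begin

text \<open>The index maps \<open>p0\<close> and \<open>p1\<close> list the two cycles of \<open>b\<close>, and \<open>a\<close> maps the entry at
  position \<open>t\<close> of the first to the entry at position \<open>m * t + d\<close> of the second, modulo \<open>n\<close>.\<close>

lemma split_metacyclic_intro:
  fixes n m d w :: nat and p0 p1 u :: "nat \<Rightarrow> nat"
  assumes card: "CARD('a) = 2 * n" and n: "0 < n"
    and p0: "\<And>t. t < n \<Longrightarrow> p0 t < 2 * n" and p1: "\<And>t. t < n \<Longrightarrow> p1 t < 2 * n"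
    and inj0: "\<And>s t. s < n \<Longrightarrow> t < n \<Longrightarrow> p0 s = p0 t \<Longrightarrow> s = t"
    and inj1: "\<And>s t. s < n \<Longrightarrow> t < n \<Longrightarrow> p1 s = p1 t \<Longrightarrow> s = t"
    and disj: "\<And>s t. s < n \<Longrightarrow> t < n \<Longrightarrow> p0 s \<noteq> p1 t"
    and u: "\<And>t. t < n \<Longrightarrow> u t < n"
    and swap: "\<And>t. t < n \<Longrightarrow> (if even (p0 t) then p0 t + 1 else p0 t - 1) = p1 (u t)"
    and affine: "\<And>t. t < n \<Longrightarrow> \<exists>z. m * t + d = u t + n * z"
    and mm: "m * m = n * w + 1"
  shows "split_metacyclic (perm_a c CARD('a))
    (cycle_prod [map (\<lambda>t. c (p0 t)) [0..<n], map (\<lambda>t. c (p1 t)) [0..<n]]) n m"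
proof -
  define a where "a = perm_a c CARD('a)"
  let ?l0 = "map (\<lambda>t. c (p0 t)) [0..<n]" and ?l1 = "map (\<lambda>t. c (p1 t)) [0..<n]"
  define b where "b = cycle_prod [?l0, ?l1]"
  \<comment> \<open>Extending the position maps periodically makes b the shift s -> s + 1 on both
    cycles, with no wrap-around case.\<close>
  define P0 P1 where "P0 s = c (p0 (s mod n))" and "P1 s = c (p1 (s mod n))" for s
  have lt: "s mod n < n" for s using n by simp
  have P1_cong: "P1 s = P1 t" if "s mod n = t mod n" for s t
    using that by (simp add: P1_def)
  have dist: "distinct (concat [?l0, ?l1])"
    using p0 p1 inj0 inj1 disj
    by (auto simp: distinct_map inj_on_def c_eq_iff card)
  have cover: "\<exists>s. x = P0 s \<or> x = P1 s" for x
  proof -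
    \<comment> \<open>The 2n entries are distinct, so by counting they exhaust the field.\<close>
    have "card (set (?l0 @ ?l1)) = CARD('a)"
      using dist by (subst distinct_card) (simp_all add: card)
    then have "set (?l0 @ ?l1) = UNIV" by (intro card_subset_eq) simp_all
    then have "x \<in> set (?l0 @ ?l1)" by simp
    then obtain t where "t < n" "x = c (p0 t) \<or> x = c (p1 t)" by auto
    then show ?thesis by (intro exI[of _ t]) (simp add: P0_def P1_def)
  qed
  have b0: "b (P0 s) = P0 (Suc s)" and b1: "b (P1 s) = P1 (Suc s)" for s
    using cycle_prod_nth[OF dist, of ?l0 "s mod n"] cycle_prod_nth[OF dist, of ?l1 "s mod n"] lt
    by (simp_all add: b_def P0_def P1_def mod_Suc_eq)
  have bj0: "(b ^^ j) (P0 s) = P0 (s + j)" and bj1: "(b ^^ j) (P1 s) = P1 (s + j)" for j s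
    by (induction j) (simp_all add: b0 b1)
  have aa: "a (a x) = x" for x
    using fun_cong[OF perm_a_involution, of x] by (simp add: a_def card)
  have a0: "a (P0 s) = P1 (m * s + d)" for s
  proof -
    have "a (P0 s) = c (p1 (u (s mod n)))"
      using perm_a_c[of "p0 (s mod n)"] p0[OF lt, of s] swap[OF lt, of s] card
      by (simp add: a_def P0_def)
    also have "\<dots> = P1 (u (s mod n))" using u[OF lt] by (simp add: P1_def)
    also have "\<dots> = P1 (m * s + d)"
    proof (rule P1_cong)
      obtain z where "m * (s mod n) + d = u (s mod n) + n * z" using affine[OF lt] by blast
      then have "u (s mod n) mod n = (m * (s mod n) + d) mod n" by simp
      also have "\<dots> = (m * s + d) mod n" by (metis mod_add_left_eq mod_mult_right_eq)
      finally show "u (s mod n) mod n = (m * s + d) mod n" .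
    qed
    finally show ?thesis .
  qed
  have a1: "\<exists>s'. P1 s = a (P0 s')" for s
  proof
    \<comment> \<open>Here v represents -d modulo n. Since m^2 = 1 modulo n, the congruence m s' + d
      = s has the solution s' = m (s - d).\<close>
    define v where "v = (n - 1) * d"
    have v: "v + d = n * d" using n by (cases n) (simp_all add: v_def)
    let ?s = "m * (s + v)"
    have "m * ?s + d = (m * m) * (s + v) + d" by (simp add: mult.assoc)
    also have "\<dots> = n * (w * (s + v)) + (s + (v + d))"
      unfolding mm by (simp add: algebra_simps)
    also note v
    finally have "(m * ?s + d) mod n = s mod n" by simp
    then show "P1 s = a (P0 ?s)" by (simp only: a0) (rule P1_cong, simp)
  qed
  have ab0: "a (b (P0 s)) = (b ^^ m) (a (P0 s))" for s
    by (simp add: b0 a0 bj1 add_ac)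
  \<comment> \<open>On the second cycle, written as the image of the first under a, the relation
    again rests on m^2 = 1: advancing by one there is advancing by m in the first cycle.\<close>
  have ab1: "a (b (a (P0 s))) = (b ^^ m) (P0 s)" for s
  proof -
    have "m * (s + m) + d = n * w + Suc (m * s + d)"
      using mm by (simp add: algebra_simps)
    then have "Suc (m * s + d) mod n = (m * (s + m) + d) mod n" by (simp only: mod_mult_self4)
    then have "b (a (P0 s)) = a (P0 (s + m))"
      unfolding a0 b1 by (rule P1_cong)
    then show ?thesis by (simp add: aa bj0)
  qed
  have "split_metacyclic a b n m"
  proof
    show "b ^^ n = id"
    proof
      fix x show "(b ^^ n) x = id x"
        using cover[of x] by (auto simp: bj0 bj1) (simp_all add: P0_def P1_def)
    qed
    show "b ^^ j \<noteq> id" if "0 < j" "j < n" for j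
    proof
      assume "b ^^ j = id"
      then have "P0 j = P0 0" using bj0[of j 0] by simp
      then have "c (p0 j) = c (p0 0)" using that by (simp add: P0_def)
      then have "p0 j = p0 0" using p0[of j] p0[of 0] that by (simp add: c_eq_iff card)
      then show False using inj0[of j 0] that by simp
    qed
    show "a (b x) = (b ^^ m) (a x)" for x
      using cover[of x] a1 ab0 ab1 by (metis aa)
  qed (use aa n in auto)
  then show ?thesis by (simp add: a_def b_def)
qed

text \<open>The segments occupy the positions below k, from k to 2k - 3, and the last two. All
  boundaries are even because k is, as pairing requires.\<close>

lemma cycC1_eq:
  assumes "k = 2 * g" "0 < g"
  shows "cycC1 c k = map (\<lambda>t. c (C1_index k t)) [0..<2 * k]"
proof -
  let ?p = "\<lambda>t. c (C1_index k t)"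
  have 1: "concat (map (\<lambda>i. [c (2*i), c (2*(2*i+k-1))]) [0..<k div 2]) = map ?p [2 * 0..<2 * (k div 2)]"
  proof (rule concat_map_pairs)
    fix i
    assume "i < k div 2"
    then have "i < g" "2 * (0 + i) \<noteq> 2 * k - 2" "2 * (0 + i) + 1 \<noteq> 2 * k - 2"
      using assms by simp_all
    then show "?p (2 * (0 + i)) = c (2*i) \<and> ?p (2 * (0 + i) + 1) = c (2*(2*i+k-1))"
      unfolding C1_index_def using assms by (simp)
  qed simp
  have 2: "concat (map (\<lambda>i. [c (2*i+k), c (2*(2*i+k))]) [0..<k div 2 - 1]) = map ?p [2 * (k div 2)..<2 * (k - 1)]"
    by (rule concat_map_pairs) (use assms in \<open>auto simp: C1_index_def intro!: arg_cong[where f = c]\<close>)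
  \<comment> \<open>The final pair is recast as a segment of length one to fit
    \<open>concat_map_pairs\<close>.\<close>
  have "[c (4*k-1), c (4*k-4)] = concat (map (\<lambda>_. [c (4*k-1), c (4*k-4)]) [0..<1::nat])" by simp
  also have "\<dots> = map ?p [2 * (k - 1)..<2 * k]"
    by (rule concat_map_pairs) (use assms in \<open>auto simp: C1_index_def intro!: arg_cong[where f = c]\<close>)
  finally have 3: "[c (4*k-1), c (4*k-4)] = map ?p [2 * (k - 1)..<2 * k]" .
  have split: "[0..<2 * k] = [2 * 0..<2 * (k div 2)] @ [2 * (k div 2)..<2 * (k - 1)] @ [2 * (k - 1)..<2 * k]"
    using upt_split3[of "2 * (k div 2)" "2 * (k - 1)" "2 * k"] assms by auto
  show ?thesis by (simp only: cycC1_def split map_append 1 2 3)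
qed

lemma cycC2_eq:
  assumes "k = 2 * g" "0 < g"
  shows "cycC2 c k = map (\<lambda>t. c (C2_index k t)) [0..<2 * k]"
proof -
  let ?p = "\<lambda>t. c (C2_index k t)"
  have 1: "concat (map (\<lambda>i. [c (2*i+1), c (2*(2*i+k)+1)]) [0..<k div 2]) = map ?p [2 * 0..<2 * (k div 2)]"
  proof (rule concat_map_pairs)
    fix i
    assume "i < k div 2"
    then have "i < g" "2 * (0 + i) \<noteq> 2 * k - 2" "2 * (0 + i) + 1 \<noteq> 2 * k - 2"
      using assms by simp_all
    then show "?p (2 * (0 + i)) = c (2*i+1) \<and> ?p (2 * (0 + i) + 1) = c (2*(2*i+k)+1)"
      unfolding C2_index_def using assms by (simp)
  qed simp
  have 2: "concat (map (\<lambda>i. [c (2*i+k+1), c (2*(2*i+k)-1)]) [0..<k div 2 - 1]) = map ?p [2 * (k div 2)..<2 * (k - 1)]"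
    by (rule concat_map_pairs) (use assms in \<open>auto simp: C2_index_def intro!: arg_cong[where f = c]\<close>)
  have "[c (4*k-2), c (4*k-5)] = concat (map (\<lambda>_. [c (4*k-2), c (4*k-5)]) [0..<1::nat])" by simp
  also have "\<dots> = map ?p [2 * (k - 1)..<2 * k]"
    by (rule concat_map_pairs) (use assms in \<open>auto simp: C2_index_def intro!: arg_cong[where f = c]\<close>)
  finally have 3: "[c (4*k-2), c (4*k-5)] = map ?p [2 * (k - 1)..<2 * k]" .
  have split: "[0..<2 * k] = [2 * 0..<2 * (k div 2)] @ [2 * (k div 2)..<2 * (k - 1)] @ [2 * (k - 1)..<2 * k]"
    using upt_split3[of "2 * (k div 2)" "2 * (k - 1)" "2 * k"] assms by auto
  show ?thesis by (simp only: cycC2_def split map_append 1 2 3)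
qed

lemma cycD1_eq:
  assumes "k = 2 * g" "0 < g"
  shows "cycD1 c k = map (\<lambda>t. c (D1_index k t)) [0..<2 * k]"
proof -
  let ?p = "\<lambda>t. c (D1_index k t)"
  have 1: "concat (map (\<lambda>i. [c (2*i), c (2*i+2*k+1)]) [0..<k div 2]) = map ?p [2 * 0..<2 * (k div 2)]"
    by (rule concat_map_pairs) (use assms in \<open>auto simp: D1_index_def intro!: arg_cong[where f = c]\<close>)
  have "[c (k+1), c (3*k)] = concat (map (\<lambda>_. [c (k+1), c (3*k)]) [0..<1::nat])" by simp
  also have "\<dots> = map ?p [2 * (k div 2)..<2 * (k div 2 + 1)]"
    by (rule concat_map_pairs) (use assms in \<open>auto simp: D1_index_def intro!: arg_cong[where f = c]\<close>)
  finally have 2: "[c (k+1), c (3*k)] = map ?p [2 * (k div 2)..<2 * (k div 2 + 1)]" .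
  have 3: "concat (map (\<lambda>i. [c (k+2*i+2), c (3*k+2*i+2)]) [0..<k div 2 - 1]) = map ?p [2 * (k div 2 + 1)..<2 * k]"
    by (rule concat_map_pairs) (use assms in \<open>auto simp: D1_index_def intro!: arg_cong[where f = c]\<close>)
  have split: "[0..<2 * k] = [2 * 0..<2 * (k div 2)] @ [2 * (k div 2)..<2 * (k div 2 + 1)] @ [2 * (k div 2 + 1)..<2 * k]"
    using upt_split3[of "2 * (k div 2)" "2 * (k div 2 + 1)" "2 * k"] assms by auto
  show ?thesis by (simp only: cycD1_def split map_append 1 2 3)
qed

lemma cycD2_eq:
  assumes "k = 2 * g" "0 < g"
  shows "cycD2 c k = map (\<lambda>t. c (D2_index k t)) [0..<2 * k]"
proof -
  let ?p = "\<lambda>t. c (D2_index k t)"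
  have 1: "concat (map (\<lambda>i. [c (3*k-2-2*i), c (2*k-1-2*i)]) [0..<k div 2 - 1]) = map ?p [2 * 0..<2 * (k div 2 - 1)]"
    by (rule concat_map_pairs) (use assms in \<open>auto simp: D2_index_def intro!: arg_cong[where f = c]\<close>)
  have "[c (2*k), c (k)] = concat (map (\<lambda>_. [c (2*k), c (k)]) [0..<1::nat])" by simp
  also have "\<dots> = map ?p [2 * (k div 2 - 1)..<2 * (k div 2)]"
    by (rule concat_map_pairs) (use assms in \<open>auto simp: D2_index_def intro!: arg_cong[where f = c]\<close>)
  finally have 2: "[c (2*k), c (k)] = map ?p [2 * (k div 2 - 1)..<2 * (k div 2)]" .
  have 3: "concat (map (\<lambda>i. [c (4*k-1-2*i), c (k-1-2*i)]) [0..<k div 2]) = map ?p [2 * (k div 2)..<2 * k]"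
    by (rule concat_map_pairs) (use assms in \<open>auto simp: D2_index_def intro!: arg_cong[where f = c]\<close>)
  have split: "[0..<2 * k] = [2 * 0..<2 * (k div 2 - 1)] @ [2 * (k div 2 - 1)..<2 * (k div 2)] @ [2 * (k div 2)..<2 * k]"
    using upt_split3[of "2 * (k div 2 - 1)" "2 * (k div 2)" "2 * k"] assms by auto
  show ?thesis by (simp only: cycD2_def split map_append 1 2 3)
qed

lemma split_metacyclic_G1:
  assumes card: "CARD('a) = 4 * k" and k: "4 dvd k" "0 < k"
  shows "split_metacyclic (perm_a c CARD('a)) (perm_b1 c CARD('a)) (2 * k) (k + 1)"
proof -
  obtain h where h: "k = 4 * h" "0 < h" using k by auto
  then obtain g where g: "k = 4 * g + 4" by (cases h) auto
  have "split_metacyclic (perm_a c CARD('a))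
    (cycle_prod [map (\<lambda>t. c (C1_index k t)) [0..<2 * k], map (\<lambda>t. c (C2_index k t)) [0..<2 * k]]) (2 * k) (k + 1)"
  \<comment> \<open>\<open>C_swap\<close> fixes even positions and shifts odd ones by k, which is
    multiplication by k + 1 modulo 2k. In all three groups d is the position of the image of the
    first entry under a, and w is the quotient of m^2 - 1 by 2k.\<close>
  proof (rule split_metacyclic_intro[where u = "C_swap k" and d = 0 and w = "2 * h + 1"])
    show "\<exists>z. (k + 1) * t + 0 = C_swap k t + 2 * k * z" if "t < 2 * k" for t
    proof (cases "even t")
      case True
      then show ?thesis by (intro exI[of _ "t div 2"]) (auto simp: C_swap_def)
    next
      case False
      then show ?thesis
        by (intro exI[of _ "if t < k then t div 2 else t div 2 + 1"])
          (auto simp: C_swap_def algebra_simps elim!: oddE)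
    qed
    show "(k + 1) * (k + 1) = 2 * k * (2 * h + 1) + 1" using h by (simp add: algebra_simps)
    show "CARD('a) = 2 * (2 * k)" using card by simp
  qed (use k in simp, (rule C_less1[OF g] C_less2[OF g] C_inj1[OF g] C_inj2[OF g] C_disjoint[OF g] C_swap_less[OF g] C_swap[OF g]; assumption)+)
  then show ?thesis
    using card h cycC1_eq[of k "2 * h"] cycC2_eq[of k "2 * h"] by (simp add: perm_b1_def)
qed

lemma split_metacyclic_G2:
  assumes card: "CARD('a) = 4 * k" and k: "0 < k"
  shows "split_metacyclic (perm_a c CARD('a)) (perm_b2 c CARD('a)) (2 * k) (2 * k - 1)"
proof -
  have "split_metacyclic (perm_a c CARD('a))
    (cycle_prod [map (\<lambda>t. c (B1_index k t)) [0..<2 * k], map (\<lambda>t. c (B2_index k t)) [0..<2 * k]]) (2 * k) (2 * k - 1)"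
  \<comment> \<open>\<open>B_swap\<close> is the reflection t -> k - 1 - t modulo 2k; the factor -1
    appears as 2k - 1.\<close>
  proof (rule split_metacyclic_intro[where u = "B_swap k" and d = "k - 1" and w = "2 * k - 2"])
    show "\<exists>z. (2 * k - 1) * t + (k - 1) = B_swap k t + 2 * k * z" if "t < 2 * k" for t
    proof (intro exI[of _ "if t < k then t else t - 1"])
      obtain k' where "k = Suc k'" using k by (cases k) auto
      then show "(2 * k - 1) * t + (k - 1) = B_swap k t + 2 * k * (if t < k then t else t - 1)"
        using that by (cases t) (auto simp: B_swap_def algebra_simps)
    qed
    show "(2 * k - 1) * (2 * k - 1) = 2 * k * (2 * k - 2) + 1"
      using k by (cases k) (simp_all add: algebra_simps)
    show "CARD('a) = 2 * (2 * k)" using card by simp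
  qed (use k in simp, (rule B_less1[OF k] B_less2[OF k] B_inj1[OF k] B_inj2[OF k] B_disjoint[OF k] B_swap_less[OF k] B_swap[OF k]; assumption)+)
  moreover have "rev (map (\<lambda>i. c (2 * i)) [0..<k]) @ map (\<lambda>i. c (2 * k + 2 * i)) [0..<k]
      = map (\<lambda>t. c (B1_index k t)) [0..<2 * k]"
    by (rule nth_equalityI) (auto simp: nth_append rev_nth B1_index_def intro!: arg_cong[where f = c])
  moreover have "map (\<lambda>i. c (2 * i + 1)) [0..<k] @ rev (map (\<lambda>i. c (2 * k + 1 + 2 * i)) [0..<k])
      = map (\<lambda>t. c (B2_index k t)) [0..<2 * k]"
    by (rule nth_equalityI) (auto simp: nth_append rev_nth B2_index_def intro!: arg_cong[where f = c])
  ultimately show ?thesis using card by (simp add: perm_b2_def)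
qed

lemma split_metacyclic_G3:
  assumes card: "CARD('a) = 4 * k" and k: "4 dvd k" "0 < k"
  shows "split_metacyclic (perm_a c CARD('a)) (perm_b3 c CARD('a)) (2 * k) (k - 1)"
proof -
  obtain h where h: "k = 4 * h" "0 < h" using k by auto
  then obtain g where g: "k = 4 * g + 4" by (cases h) auto
  have "split_metacyclic (perm_a c CARD('a))
    (cycle_prod [map (\<lambda>t. c (D1_index k t)) [0..<2 * k], map (\<lambda>t. c (D2_index k t)) [0..<2 * k]]) (2 * k) (k - 1)"
  \<comment> \<open>\<open>D_swap\<close> is t -> (k - 1) t - 1 modulo 2k: since k t is 0 or k
    modulo 2k according to the parity of t, it is -t - 1 on even and k - t - 1 on odd
    positions.\<close>
  proof (rule split_metacyclic_intro[where u = "D_swap k" and d = "2 * k - 1" and w = "2 * h - 1"])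
    show "\<exists>z. (k - 1) * t + (2 * k - 1) = D_swap k t + 2 * k * z" if t: "t < 2 * k" for t
    proof (cases "even t")
      case True
      then obtain s where s: "t = 2 * s" by (elim evenE)
      obtain k' where "k = Suc k'" using k by (cases k) auto
      with s t show ?thesis by (intro exI[of _ s]) (auto simp: D_swap_def algebra_simps)
    next
      case False
      then obtain s where s: "t = 2 * s + 1" by (elim oddE)
      show ?thesis
      proof (cases "t < k")
        case True
        \<comment> \<open>The slack v replaces the truncated subtractions by sums.\<close>
        then obtain v where v: "k = 2 * s + 2 + v" using s le_Suc_ex[of "2 * s + 2" k] by auto
        show ?thesis by (intro exI[of _ "s + 1"]) (simp add: D_swap_def s v algebra_simps)
      next
        case False
        obtain v where v: "k = s + 1 + v" using s t le_Suc_ex[of "s + 1" k] by auto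
        show ?thesis using False by (intro exI[of _ s]) (simp add: D_swap_def s v algebra_simps)
      qed
    qed
    show "(k - 1) * (k - 1) = 2 * k * (2 * h - 1) + 1"
      using h by (cases h) (simp_all add: algebra_simps)
    show "CARD('a) = 2 * (2 * k)" using card by simp
  qed (use k in simp, (rule D_less1[OF g] D_less2[OF g] D_inj1[OF g] D_inj2[OF g] D_disjoint[OF g] D_swap_less[OF g] D_swap[OF g]; assumption)+)
  then show ?thesis
    using card h cycD1_eq[of k "2 * h"] cycD2_eq[of k "2 * h"] by (simp add: perm_b3_def)
qed

end

section \<open>Equivalence as conjugation, and the Klenian groups\<close>

text \<open>If \<open>id = \<sigma> \<circ> h \<circ> \<tau>\<close> with \<open>h\<close> in the source, then \<open>x \<mapsto> \<sigma> \<circ> (x \<circ> h) \<circ> \<tau>\<close> is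
  conjugation by \<open>\<sigma>\<close>.\<close>

lemma lpp_equiv_conjugation:
  fixes c :: "nat \<Rightarrow> 'a::finite"
  assumes "lpp_equiv c f g" and id: "id \<in> ppt_set c g"
    and closed: "\<And>x y. x \<in> ppt_set c f \<Longrightarrow> y \<in> ppt_set c f \<Longrightarrow> x \<circ> y \<in> ppt_set c f"
  obtains \<phi> where "inj \<phi>" "\<phi> id = id" "\<And>x y. \<phi> (x \<circ> y) = \<phi> x \<circ> \<phi> y"
    "\<And>x. x \<in> ppt_set c f \<Longrightarrow> \<phi> x \<in> ppt_set c g"
proof -
  obtain \<sigma> \<tau> where \<sigma>: "bij \<sigma>" and \<tau>: "bij \<tau>"
    and eq: "\<And>i. i < CARD('a) \<Longrightarrow> ppt c g i = \<sigma> \<circ> ppt c f i \<circ> \<tau>"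
    using assms(1) by (auto simp: lpp_equiv_def)
  have set_eq: "ppt_set c g = (\<lambda>h. \<sigma> \<circ> h \<circ> \<tau>) ` ppt_set c f"
    using eq by (auto simp: ppt_set_def image_image)
  with id obtain h where h: "h \<in> ppt_set c f" "\<sigma> \<circ> h \<circ> \<tau> = id" by auto
  have inv: "inv \<sigma> \<circ> \<sigma> = id" "\<sigma> \<circ> inv \<sigma> = id"
    using \<sigma> by (auto simp: bij_def surj_iff)
  have h\<tau>: "h \<circ> \<tau> = inv \<sigma>"
    using h(2) inv(1) by (metis comp_assoc comp_id id_comp)
  show ?thesis
  proof (rule that[of "\<lambda>x. \<sigma> \<circ> x \<circ> inv \<sigma>"])
    show "inj (\<lambda>x. \<sigma> \<circ> x \<circ> inv \<sigma>)"
    proof (rule injI)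
      fix x y assume *: "\<sigma> \<circ> x \<circ> inv \<sigma> = \<sigma> \<circ> y \<circ> inv \<sigma>"
      have "z = inv \<sigma> \<circ> (\<sigma> \<circ> z \<circ> inv \<sigma>) \<circ> \<sigma>" for z
        using inv by (metis comp_assoc comp_id id_comp)
      then show "x = y" using * by metis
    qed
    show "\<sigma> \<circ> id \<circ> inv \<sigma> = id" using inv by simp
    show "\<sigma> \<circ> (x \<circ> y) \<circ> inv \<sigma> = (\<sigma> \<circ> x \<circ> inv \<sigma>) \<circ> (\<sigma> \<circ> y \<circ> inv \<sigma>)" for x y
      using inv(1) by (metis comp_assoc id_comp)
    show "\<sigma> \<circ> x \<circ> inv \<sigma> \<in> ppt_set c g" if "x \<in> ppt_set c f" for x
    proof -
      have "\<sigma> \<circ> x \<circ> inv \<sigma> = \<sigma> \<circ> (x \<circ> h) \<circ> \<tau>" by (simp add: comp_assoc flip: h\<tau>)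
      then show ?thesis using set_eq closed[OF that h(1)] by auto
    qed
  qed
qed

text \<open>The criteria below take the group with the inherited property as target; symmetry
  reverses the direction where the theorem asks for it.\<close>

lemma lpp_equiv_sym:
  assumes "lpp_equiv c f g" shows "lpp_equiv c g f"
proof -
  obtain \<sigma> \<tau> where \<sigma>: "bij \<sigma>" and \<tau>: "bij \<tau>"
    and eq: "\<And>i. i < CARD('a) \<Longrightarrow> ppt c g i = \<sigma> \<circ> ppt c f i \<circ> \<tau>"
    using assms by (auto simp: lpp_equiv_def)
  have "ppt c f i = inv \<sigma> \<circ> ppt c g i \<circ> inv \<tau>" if "i < CARD('a)" for i
    using \<sigma> \<tau> eq[OF that] by (auto simp: bij_def surj_f_inv_f)
  then show ?thesis
    using \<sigma> \<tau> bij_imp_bij_inv unfolding lpp_equiv_def by blast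
qed

lemma funpow_commute:
  assumes "\<And>x. f (g x) = g (f x)"
  shows "(f ^^ i) ((g ^^ j) x) = (g ^^ j) ((f ^^ i) x)"
proof -
  have "f ((g ^^ j) x) = (g ^^ j) (f x)" for x
    by (induction j) (simp_all add: assms)
  then show ?thesis by (induction i) simp_all
qed

lemma (in enumeration) klenian_group_commute:
  assumes l: "l dvd CARD('a)"
    and "g \<in> klenian_group c CARD('a) l" "h \<in> klenian_group c CARD('a) l"
  shows "g \<circ> h = h \<circ> g"
proof -
  let ?A = "klen_alpha c CARD('a) l" and ?B = "klen_beta c CARD('a) l"
  have AB: "?A (?B x) = ?B (?A x)" for x
    using fun_cong[OF klen_alpha_beta_commute[OF l], of x] by simp
  obtain i j i' j' where g: "g = (?A ^^ i) \<circ> (?B ^^ j)" and h: "h = (?A ^^ i') \<circ> (?B ^^ j')"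
    using assms(2,3) by (auto simp: klenian_group_def)
  have "(?A ^^ i) ((?A ^^ i') x) = (?A ^^ i') ((?A ^^ i) x)"
    "(?B ^^ j) ((?B ^^ j') x) = (?B ^^ j') ((?B ^^ j) x)"
    "(?B ^^ j) ((?A ^^ i') x) = (?A ^^ i') ((?B ^^ j) x)"
    "(?B ^^ j') ((?A ^^ i) x) = (?A ^^ i) ((?B ^^ j') x)" for x
    by (intro funpow_commute, simp add: AB)+
  then show ?thesis unfolding g h by (intro ext) simp
qed

lemma id_in_klenian_group:
  assumes "l dvd q" "0 < q"
  shows "id \<in> klenian_group c q l"
proof -
  have "0 < l" "0 < q div l" using assms by (auto intro: Nat.gr0I simp: div_greater_zero_iff dvd_imp_le)
  then show ?thesis unfolding klenian_group_def by force
qed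

section \<open>Properties separating the groups\<close>

context split_metacyclic
begin

lemma id_mem: "id \<in> group_from b a n"
  using b_pow_mem[of 0] by simp

lemma a_mem: "a \<in> group_from b a n"
  using b_pow_a_mem[of 0] by simp

lemma b_mem: "b \<in> group_from b a n"
  using b_pow_mem[of 1] by simp

text \<open>This controls all squares outside the powers of b: they are trivial if n divides m + 1,
  and even powers of b if m is odd.\<close>

lemma reflection_square: "((b ^^ j) \<circ> a) \<circ> ((b ^^ j) \<circ> a) = b ^^ (j * (m + 1))"
  by (auto simp: funpow_add a_b_pow a_a algebra_simps)

text \<open>When n divides m + 1, every b^j a squares to the identity. An element with nontrivial
  square is therefore a power of b, and such powers commute.\<close>

lemma dihedral_noninvolutions_commute:
  assumes "n dvd m + 1" and g: "g \<in> group_from b a n" "g \<circ> g \<noteq> id"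
    and h: "h \<in> group_from b a n" "h \<circ> h \<noteq> id"
  shows "g \<circ> h = h \<circ> g"
proof -
  have rotation: "\<exists>j. x = b ^^ j" if "x \<in> group_from b a n" "x \<circ> x \<noteq> id" for x
    using that(1)
  proof (cases rule: group_cases)
    case (2 j)
    then have "x \<circ> x = b ^^ (j * (m + 1))" using reflection_square[of j] by simp
    moreover have "b ^^ (j * (m + 1)) = id"
      unfolding b_pow_id_iff using assms(1) by (rule dvd_mult)
    ultimately show ?thesis using that(2) by simp
  qed auto
  obtain i j where "g = b ^^ i" "h = b ^^ j" using rotation g h by blast
  then show ?thesis by (simp add: funpow_comp add.commute)
qed

text \<open>The witnesses are b and b a, with squares b^2 and b^(m+1). If they commuted, evaluating
  at a x would give b^2 = b^(m+1), so n would divide m - 1.\<close>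

lemma noncommuting_noninvolutions:
  assumes "\<not> n dvd 2" "\<not> n dvd m + 1" "\<not> n dvd m - 1" "1 \<le> m"
  obtains x y where "x \<in> group_from b a n" "y \<in> group_from b a n"
    "x \<circ> x \<noteq> id" "y \<circ> y \<noteq> id" "x \<circ> y \<noteq> y \<circ> x"
proof
  show "b \<in> group_from b a n" "b \<circ> a \<in> group_from b a n"
    using b_mem b_pow_a_mem[of 1] by simp_all
  have "b \<circ> b = b ^^ 2" by (simp add: numeral_2_eq_2)
  then show "b \<circ> b \<noteq> id" using assms(1) b_pow_id_iff by simp
  show "(b \<circ> a) \<circ> (b \<circ> a) \<noteq> id"
    using reflection_square[of 1] assms(2) b_pow_id_iff[of "m + 1"] by simp
  show "b \<circ> (b \<circ> a) \<noteq> (b \<circ> a) \<circ> b"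
  proof
    assume *: "b \<circ> (b \<circ> a) = (b \<circ> a) \<circ> b"
    have "b (b x) = b ((b ^^ m) x)" for x
      using fun_cong[OF *, of "a x"] by (simp add: a_b a_a)
    then have "b ^^ 2 = b ^^ (m + 1)" by (auto simp: numeral_2_eq_2)
    then show False using b_pow_eq_imp_dvd[of 2 "m + 1"] assms(3,4) by simp
  qed
qed

text \<open>For odd m every square is some b^(2i). Conjugation by a adds 2(m - 1)i to its exponent,
  a multiple of n.\<close>

lemma squares_central:
  assumes "odd m" and "n dvd 2 * (m - 1)"
    and "g \<in> group_from b a n" "h \<in> group_from b a n"
  shows "(g \<circ> g) \<circ> h = h \<circ> (g \<circ> g)"
proof -
  have "\<exists>i. g \<circ> g = b ^^ (2 * i)"
    using assms(3)
  proof (cases rule: group_cases)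
    case (1 j)
    then show ?thesis by (auto simp: funpow_comp mult_2)
  next
    case (2 j)
    have "even (j * (m + 1))" using assms(1) by auto
    then show ?thesis using 2 reflection_square[of j] by (metis evenE)
  qed
  then obtain i where i: "g \<circ> g = b ^^ (2 * i)" by blast
  have "m \<ge> 1" using assms(1) by (cases m) auto
  then have "m * (2 * i) = 2 * i + 2 * (m - 1) * i"
    by (cases m) (simp_all add: algebra_simps)
  then have "(m * (2 * i)) mod n = (2 * i) mod n"
    using assms(2) by (metis dvd_mult2 mod_add_right_eq mod_0_imp_dvd add_0_right dvd_imp_mod_0)
  then have "b ^^ (m * (2 * i)) = b ^^ (2 * i)" by (metis b_pow_mod)
  then have a: "a ((b ^^ (2 * i)) x) = (b ^^ (2 * i)) (a x)" for x
    by (simp only: a_b_pow)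
  have b: "(b ^^ j) ((b ^^ i) x) = (b ^^ i) ((b ^^ j) x)" for i j x
    by (metis add.commute comp_apply funpow_add)
  show ?thesis unfolding i
    using assms(4) by (cases rule: group_cases) (auto simp: a b)
qed

text \<open>Conjugation by a sends b^2 to b^(2m), which differs from b^2 unless n divides 2(m -
  1).\<close>

lemma square_not_central:
  assumes "\<not> n dvd 2 * (m - 1)" "1 \<le> m"
  shows "(b \<circ> b) \<circ> a \<noteq> a \<circ> (b \<circ> b)"
proof
  assume *: "(b \<circ> b) \<circ> a = a \<circ> (b \<circ> b)"
  have "(b ^^ 2) x = (b ^^ (m * 2)) x" for x
    using fun_cong[OF *, of "a x"] a_b_pow[of 2 "a x"] by (simp add: a_a numeral_2_eq_2)
  then have "b ^^ 2 = b ^^ (m * 2)" by blast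
  then show False using b_pow_eq_imp_dvd[of 2 "m * 2"] assms by (simp add: diff_mult_distrib2 mult.commute)
qed

end

section \<open>Inequivalence criteria in terms of n and m\<close>

lemma not_equiv_commutative:
  assumes X: "split_metacyclic a b n m" and f: "ppt_set c f = group_from b a n"
    and m: "\<not> n dvd m - 1" "1 \<le> m"
    and g: "id \<in> ppt_set c g" "\<And>x y. x \<in> ppt_set c g \<Longrightarrow> y \<in> ppt_set c g \<Longrightarrow> x \<circ> y = y \<circ> x"
  shows "\<not> lpp_equiv c f g"
proof
  interpret X: split_metacyclic a b n m by (rule X)
  assume "lpp_equiv c f g"
  then obtain \<phi> where \<phi>: "inj \<phi>" "\<And>x y. \<phi> (x \<circ> y) = \<phi> x \<circ> \<phi> y"
    "\<And>x. x \<in> ppt_set c f \<Longrightarrow> \<phi> x \<in> ppt_set c g"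
    by (rule lpp_equiv_conjugation) (use f g(1) X.group_closed in auto)
  have "\<phi> (a \<circ> b) = \<phi> (b \<circ> a)"
    unfolding \<phi>(2) using g(2) \<phi>(3) X.a_mem X.b_mem f by simp
  then show False using \<phi>(1) X.not_commute[OF m] by (auto dest: injD)
qed

lemma not_equiv_dihedral:
  assumes X: "split_metacyclic a b n m" and Y: "split_metacyclic a' b' n' m'"
    and f: "ppt_set c f = group_from b a n" and g: "ppt_set c g = group_from b' a' n'"
    and "\<not> n dvd 2" "\<not> n dvd m + 1" "\<not> n dvd m - 1" "1 \<le> m" "n' dvd m' + 1"
  shows "\<not> lpp_equiv c f g"
proof
  interpret X: split_metacyclic a b n m by (rule X)
  interpret Y: split_metacyclic a' b' n' m' by (rule Y)
  assume "lpp_equiv c f g"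
  then obtain \<phi> where \<phi>: "inj \<phi>" "\<phi> id = id" "\<And>x y. \<phi> (x \<circ> y) = \<phi> x \<circ> \<phi> y"
    "\<And>x. x \<in> ppt_set c f \<Longrightarrow> \<phi> x \<in> ppt_set c g"
    by (rule lpp_equiv_conjugation) (use f g X.group_closed Y.id_mem in auto)
  obtain x y where xy: "x \<in> group_from b a n" "y \<in> group_from b a n"
    "x \<circ> x \<noteq> id" "y \<circ> y \<noteq> id" "x \<circ> y \<noteq> y \<circ> x"
    using assms(5-8) by (rule X.noncommuting_noninvolutions)
  \<comment> \<open>An injective multiplicative map fixing the identity cannot make a nontrivial
    square trivial.\<close>
  have noninv: "\<phi> z \<circ> \<phi> z \<noteq> id" if "z \<circ> z \<noteq> id" for z
    using that \<phi>(1,2) by (metis \<phi>(3) injD)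
  have "\<phi> x \<circ> \<phi> y = \<phi> y \<circ> \<phi> x"
    by (rule Y.dihedral_noninvolutions_commute[OF assms(9)])
      (use xy noninv \<phi>(4) f g in auto)
  then have "x \<circ> y = y \<circ> x" using \<phi>(1,3) by (metis injD)
  then show False using xy(5) by simp
qed

lemma not_equiv_modular:
  assumes X: "split_metacyclic a b n m" and Y: "split_metacyclic a' b' n' m'"
    and f: "ppt_set c f = group_from b a n" and g: "ppt_set c g = group_from b' a' n'"
    and "\<not> n dvd 2 * (m - 1)" "1 \<le> m" "odd m'" "n' dvd 2 * (m' - 1)"
  shows "\<not> lpp_equiv c f g"
proof
  interpret X: split_metacyclic a b n m by (rule X)
  interpret Y: split_metacyclic a' b' n' m' by (rule Y)
  assume "lpp_equiv c f g"
  then obtain \<phi> where \<phi>: "inj \<phi>" "\<And>x y. \<phi> (x \<circ> y) = \<phi> x \<circ> \<phi> y"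
    "\<And>x. x \<in> ppt_set c f \<Longrightarrow> \<phi> x \<in> ppt_set c g"
    by (rule lpp_equiv_conjugation) (use f g X.group_closed Y.id_mem in auto)
  have "(\<phi> b \<circ> \<phi> b) \<circ> \<phi> a = \<phi> a \<circ> (\<phi> b \<circ> \<phi> b)"
    by (rule Y.squares_central[OF assms(7,8)]) (use X.a_mem X.b_mem \<phi>(3) f g in auto)
  then have "(b \<circ> b) \<circ> a = a \<circ> (b \<circ> b)" using \<phi>(1,2) by (metis injD)
  then show False using X.square_not_central[OF assms(5,6)] by simp
qed

section \<open>The criteria applied to the Klenian groups and to G_1, G_2, G_3\<close>

theorem theorem3p5:
  fixes c :: "nat \<Rightarrow> 'a::{finite, field}"
    and f1 f2 f3 :: "'a \<Rightarrow> 'a \<Rightarrow> 'a"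
    and r :: nat
  assumes q: "CARD('a) = 2 ^ r"
    and r4: "r \<ge> 4"
    and c: "bij_betw c {0..<CARD('a)} UNIV"
    and f1: "is_lpp f1" "ppt_set c f1 = G1 c CARD('a)"
    and f2: "is_lpp f2" "ppt_set c f2 = G2 c CARD('a)"
    and f3: "is_lpp f3" "ppt_set c f3 = G3 c CARD('a)"
  shows "(\<forall>e < r. \<forall>g. is_e_klenian c 2 e g \<longrightarrow>
            \<not> lpp_equiv c f1 g \<and> \<not> lpp_equiv c f2 g \<and> \<not> lpp_equiv c f3 g)
       \<and> \<not> lpp_equiv c f1 f2 \<and> \<not> lpp_equiv c f1 f3 \<and> \<not> lpp_equiv c f2 f3"
proof -
  interpret enumeration c by unfold_locales (rule c)
  define k where "k = (2::nat) ^ (r - 2)"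
  have "r = (r - 2) + 2" using r4 by simp
  then have "(2::nat) ^ r = 2 ^ (r - 2) * 2 ^ 2" by (metis power_add)
  then have card: "CARD('a) = 4 * k" using q by (simp add: k_def)
  \<comment> \<open>The bound r >= 4 enters here: it makes k divisible by 4, hence k > 3 in the size
    comparisons below.\<close>
  have "(2::nat) ^ 2 dvd 2 ^ (r - 2)" using r4 by (intro le_imp_power_dvd) simp
  then have "4 dvd k" by (simp add: k_def)
  then obtain h where h: "k = 4 * h" by blast
  have "0 < k" by (simp add: k_def)
  then have "0 < h" using h by simp
  note k = \<open>4 dvd k\<close> \<open>0 < k\<close>
  note X1 = split_metacyclic_G1[OF card k] and X2 = split_metacyclic_G2[OF card k(2)]
    and X3 = split_metacyclic_G3[OF card k]
  have S1: "ppt_set c f1 = group_from (perm_b1 c CARD('a)) (perm_a c CARD('a)) (2 * k)"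
    and S2: "ppt_set c f2 = group_from (perm_b2 c CARD('a)) (perm_a c CARD('a)) (2 * k)"
    and S3: "ppt_set c f3 = group_from (perm_b3 c CARD('a)) (perm_a c CARD('a)) (2 * k)"
    using f1(2) f2(2) f3(2) by (simp_all add: G1_def G2_def G3_def card)
  have small: "\<not> 2 * k dvd j" if "0 < j" "j < 2 * k" for j
    using that by (auto dest: dvd_imp_le)
  have km: "3 < k" "1 \<le> k - 1" "1 \<le> 2 * k - 1" using h \<open>0 < h\<close> by auto
  \<comment> \<open>The three values of m - 1, namely k, 2k - 2 and k - 2, lie strictly between 0
    and 2k.\<close>
  have noncomm: "\<not> 2 * k dvd k + 1 - 1" "\<not> 2 * k dvd (2 * k - 1) - 1" "\<not> 2 * k dvd (k - 1) - 1"
    by (rule small; use km in linarith)+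
  have "\<not> lpp_equiv c f1 g \<and> \<not> lpp_equiv c f2 g \<and> \<not> lpp_equiv c f3 g"
    if "e < r" and g: "is_e_klenian c 2 e g" for e g
  proof -
    have "2 ^ e dvd CARD('a)" unfolding q using \<open>e < r\<close> by (intro le_imp_power_dvd) simp
    moreover have "ppt_set c g = klenian_group c CARD('a) (2 ^ e)"
      using g by (simp add: is_e_klenian_def)
    ultimately have "id \<in> ppt_set c g"
      and "\<And>x y. x \<in> ppt_set c g \<Longrightarrow> y \<in> ppt_set c g \<Longrightarrow> x \<circ> y = y \<circ> x"
      using id_in_klenian_group[of "2 ^ e" "CARD('a)" c] klenian_group_commute[of "2 ^ e"]
      by (simp_all add: card_gt_0_iff)
    then show ?thesis
      using not_equiv_commutative[OF X1 S1 noncomm(1)] not_equiv_commutative[OF X2 S2 noncomm(2) km(3)]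
        not_equiv_commutative[OF X3 S3 noncomm(3) km(2)] by simp
  qed
  \<comment> \<open>For G_2, m + 1 is exactly 2k, whereas for G_1 and G_3 it is k + 2 and k, both
    positive and below 2k.\<close>
  moreover have "\<not> lpp_equiv c f1 f2"
    by (rule not_equiv_dihedral[OF X1 X2 S1 S2 small small noncomm(1)]) (use km in auto)
  moreover have "\<not> lpp_equiv c f3 f2"
    by (rule not_equiv_dihedral[OF X3 X2 S3 S2 small small noncomm(3)]) (use km in auto)
  \<comment> \<open>For G_1, 2(m - 1) equals 2k and m = k + 1 is odd; for G_3, 2(m - 1) = 2k - 4 is
    not a multiple of 2k.\<close>
  moreover have "\<not> lpp_equiv c f3 f1"
  proof (rule not_equiv_modular[OF X3 X1 S3 S1])
    show "\<not> 2 * k dvd 2 * (k - 1 - 1)" by (rule small) (use km in auto)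
  qed (use km h in auto)
  ultimately show ?thesis using lpp_equiv_sym by blast
qed

end
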